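(* Let $a,b,c,k,l,m$ be positive integers with $c\mid ab$ and $k,l\ge m$, let $h=\frac{a^kb^l}{c^m}$ (a positive integer), and let $d_i^{\pm}=a^{2k}b^{2l}\pm i c^m$ for $i=1,2$, where each $d_i^\pm$ under consideration is a square-free positive integer. Let $F_{\Delta_d}=(1,0,-d)$ denote the form $x^2-dy^2$, of discriminant $\Delta_d=4d$. Then: (i) the reduction of $F_{\Delta_{d_1^+}}$ is $\rho^2(F_{\Delta_{d_1^+}})=(1,2hc^m,-c^m)$; (ii) the reduction of $F_{\Delta_{d_2^+}}$ is $\rho^2(F_{\Delta_{d_2^+}})=(1,2hc^m,-2c^m)$; (iii) the reduction of $F_{\Delta_{d_1^-}}$ is $\rho^2(F_{\Delta_{d_1^-}})=(1,2hc^m-2,1-(2h-1)c^m)$; (iv) the reduction of $F_{\Delta_{d_2^-}}$ is $\rho^2(F_{\Delta_{d_2^-}})=(1,2hc^m-2,1-2(h-1)c^m)$.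
   Context: $(A,B,C)$ denotes the binary quadratic form $Ax^2+Bxy+Cy^2$, of discriminant $\Delta=B^2-4AC$. A form with $\Delta>0$ is reduced if $|\sqrt\Delta-2|A||<B<\sqrt\Delta$. For an indefinite form $F$ write $\rho^0(F)=F$ and $\rho^j(F)=(a_j,b_j,c_j)$; the reduction operator is defined by $$\rho^{j+1}(F)=(c_j,\,-b_j+2c_jr_j,\,c_jr_j^2-b_jr_j+a_j),\qquad r_j=\begin{cases}\operatorname{sign}(c_j)\left\lfloor\frac{b_j}{2|c_j|}\right\rfloor,&|c_j|\ge\sqrt\Delta,\\[1mm]\operatorname{sign}(c_j)\left\lfloor\frac{b_j+\sqrt\Delta}{2|c_j|}\right\rfloor,&|c_j|<\sqrt\Delta.\end{cases}$$ The reduction of $F$ is the reduced form reached by iterating $\rho$ on $F$.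
   Formalization: Part (iv) is stated with the extra hypothesis h ≠ 1, since it fails for h = 1: a=c=3, b=k=l=m=1 gives d_2^- = 3, whose second iterate is (1,2,-2), not (1,4,1); h ≠ 1 is automatic if all four d_i^± are square-free. *)

theory Defs
  imports Complex_Main "HOL-Computational_Algebra.Squarefree"
begin

text \<open>The triple \<open>(A, B, C)\<close> stands for the binary quadratic form \<open>A x\<^sup>2 + B x y + C y\<^sup>2\<close>.\<close>
type_synonym bqf = "int \<times> int \<times> int"

fun disc :: "bqf \<Rightarrow> int" where
  "disc (A, B, C) = B\<^sup>2 - 4 * A * C"

fun reduced :: "bqf \<Rightarrow> bool" where
  "reduced (A, B, C) \<longleftrightarrow>
     disc (A, B, C) > 0 \<and>
     \<bar>sqrt (real_of_int (disc (A, B, C))) - 2 * \<bar>real_of_int A\<bar>\<bar> < real_of_int B \<and>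
     real_of_int B < sqrt (real_of_int (disc (A, B, C)))"

fun rho_r :: "bqf \<Rightarrow> int" where
  "rho_r (A, B, C) =
     (let s = sqrt (real_of_int (disc (A, B, C))) in
      if \<bar>real_of_int C\<bar> \<ge> s
      then sgn C * \<lfloor>real_of_int B / (2 * \<bar>real_of_int C\<bar>)\<rfloor>
      else sgn C * \<lfloor>(real_of_int B + s) / (2 * \<bar>real_of_int C\<bar>)\<rfloor>)"

fun rho :: "bqf \<Rightarrow> bqf" where
  "rho (A, B, C) =
     (let r = rho_r (A, B, C) in (C, - B + 2 * C * r, C * r\<^sup>2 - B * r + A))"

text \<open>Since \<open>rho\<close> permutes the reduced forms of a given discriminant, iterating it beyond a
  reduced form may reach further reduced forms; the reduction of \<open>F\<close> is the first one.
  \<open>is_reduction F j G\<close> says that \<open>G\<close> is the reduction of \<open>F\<close> and is reached at step \<open>j\<close>.\<close>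
definition is_reduction :: "bqf \<Rightarrow> nat \<Rightarrow> bqf \<Rightarrow> bool" where
  "is_reduction F j G \<longleftrightarrow>
     (rho ^^ j) F = G \<and> reduced G \<and> (\<forall>i<j. \<not> reduced ((rho ^^ i) F))"

definition norm_form :: "int \<Rightarrow> bqf" where
  "norm_form d = (1, 0, - d)"

text \<open>For \<open>d = a\<^sup>2\<^sup>k b\<^sup>2\<^sup>l - 2 c\<^sup>m\<close> the expected second iterate \<open>(1, 2hc\<^sup>m - 2, 1 - 2(h - 1)c\<^sup>m)\<close>
  presupposes \<open>h \<noteq> 1\<close>, where \<open>h = a\<^sup>k b\<^sup>l / c\<^sup>m\<close>.  Square-freeness of that \<open>d\<close> alone does not
  exclude \<open>h = 1\<close>: the values \<open>a = c = 3\<close>, \<open>b = k = l = m = 1\<close> give \<open>d = 3\<close>, and the form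
  \<open>(1, 4, 1)\<close> is not the second iterate, nor is it reduced.\<close>
lemma norm_form_3:
  shows "(rho ^^ 2) (norm_form 3) = (1, 2, -2)" and "\<not> reduced (1, 4, 1)"
proof -
  have s12: "sqrt 12 = 2 * sqrt 3"
    using real_sqrt_mult[of 4 3] by simp
  have lo: "1 < sqrt 3" and hi: "sqrt 3 < 2"
    by (auto intro: real_less_rsqrt real_less_lsqrt)
  have "sqrt 12 < 4"
    using s12 hi by simp
  moreover have "\<lfloor>sqrt 3\<rfloor> = 1" "\<lfloor>sqrt 3 / 3\<rfloor> = 0"
    using lo hi by (auto simp: floor_eq_iff)
  moreover have "\<not> 2 * sqrt 3 \<le> 1"
    using lo by linarith
  ultimately show "(rho ^^ 2) (norm_form 3) = (1, 2, -2)" and "\<not> reduced (1, 4, 1)"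
    by (auto simp: norm_form_def numeral_2_eq_2 Let_def s12)
qed

text \<open>If all of \<open>a\<^sup>2\<^sup>k b\<^sup>2\<^sup>l \<plusminus> i c\<^sup>m\<close> for \<open>i = 1, 2\<close> are square-free, then \<open>h \<noteq> 1\<close> is automatic.\<close>
lemma h_neq_1:
  fixes a b c :: int
  assumes "squarefree (a ^ (2 * k) * b ^ (2 * l) + c ^ m)"
    and "squarefree (a ^ (2 * k) * b ^ (2 * l) + 2 * c ^ m)"
    and "squarefree (a ^ (2 * k) * b ^ (2 * l) - c ^ m)"
  shows "a ^ k * b ^ l \<noteq> c ^ m"
proof
  assume eq: "a ^ k * b ^ l = c ^ m"
  define N where "N = c ^ m"
  have sq: "a ^ (2 * k) * b ^ (2 * l) = N\<^sup>2"
    unfolding N_def eq[symmetric] by (simp add: power_mult_distrib mult.commute flip: power_mult)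
  have no4: "\<not> 4 dvd x" if "squarefree x" for x :: int
  proof
    assume "4 dvd x"
    hence "2\<^sup>2 dvd x" by simp
    with that have "(2::int) dvd 1" unfolding squarefree_def by blast
    thus False by simp
  qed
  have "\<not> 4 dvd N\<^sup>2 + N" "\<not> 4 dvd N\<^sup>2 + 2 * N" "\<not> 4 dvd N\<^sup>2 - N"
    using assms no4 unfolding sq N_def[symmetric] by auto
  hence no: "\<not> 4 dvd N * (N + 1)" "\<not> 4 dvd N * (N + 2)" "\<not> 4 dvd N * (N - 1)"
    by (simp_all add: power2_eq_square algebra_simps)
  show False
  proof (cases "even N")
    case True
    hence "2 * 2 dvd N * (N + 2)" by (intro mult_dvd_mono) auto
    with no show False by simp
  next
    case False
    hence "4 dvd N + 1 \<or> 4 dvd N - 1" by presburger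
    with no show False by (auto intro: dvd_mult)
  qed
qed

end

theory Submission
  imports Defs
begin

text \<open>If \<open>n \<ge> 1\<close> is the integer part of \<open>\<surd>d\<close> and \<open>d\<close> is not a square, then the first step sends
  \<open>(1, 0, -d)\<close> to \<open>(-d, 0, 1)\<close>, and the second translates by \<open>n\<close> to the reduced form
  \<open>(1, 2n, n\<^sup>2 - d)\<close>.  With \<open>N = a\<^sup>k b\<^sup>l = h c\<^sup>m\<close> and \<open>c\<^sup>m \<le> N\<close>, the integer part is \<open>N\<close> for the
  discriminants with a plus sign and \<open>N - 1\<close> for those with a minus sign.\<close>

text \<open>Both branches of \<open>rho_r\<close> give the multiplier 0: in the first the numerator
  is 0, and in the second, reached for d = 2 and d = 3, the quotient is \<open>sqrt d / d\<close>,
  which lies in (0, 1).\<close>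

lemma rho_norm_form:
  assumes "d > 1"
  shows "rho (norm_form d) = (- d, 0, 1)"
proof -
  have s: "sqrt (real_of_int (4 * d)) = 2 * sqrt (real_of_int d)"
    by (simp add: real_sqrt_mult)
  have "sqrt (real_of_int d) < real_of_int d"
    using assms by (intro real_less_lsqrt) (auto simp: power2_eq_square)
  then have "\<lfloor>sqrt (real_of_int d) / real_of_int d\<rfloor> = 0"
    using assms by (simp add: floor_eq_iff)
  then show ?thesis
    using assms s by (simp add: norm_form_def Let_def)
qed

text \<open>For d > 1, reducedness of a form with first coefficient 1, middle coefficient 2n and
  discriminant 4d amounts to sqrt d - 1 < n < sqrt d, which is what the two strict bounds on d
  provide.\<close>

lemma is_reduction_norm_form:
  assumes "n \<ge> 1" and "n\<^sup>2 < d" and "d < (n + 1)\<^sup>2"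
  shows "is_reduction (norm_form d) 2 (1, 2 * n, n\<^sup>2 - d)"
proof -
  have "1 \<le> n\<^sup>2"
    using assms(1) by (simp add: one_le_power)
  with assms(2) have d: "d > 1"
    by linarith
  have s: "sqrt (real_of_int (4 * d)) = 2 * sqrt (real_of_int d)"
    by (simp add: real_sqrt_mult)
  have lo: "real_of_int n < sqrt (real_of_int d)"
    using assms(2) by (intro real_less_rsqrt) (metis of_int_less_iff of_int_power)
  have hi: "sqrt (real_of_int d) < real_of_int n + 1"
  proof (rule real_less_lsqrt)
    have "real_of_int d < real_of_int ((n + 1)\<^sup>2)"
      using assms(3) by (simp only: of_int_less_iff)
    then show "real_of_int d < (real_of_int n + 1)\<^sup>2"
      by simp
  qed (use assms(1) d in auto)
  have "\<lfloor>sqrt (real_of_int d)\<rfloor> = n"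
    using lo hi by (simp add: floor_eq_iff)
  \<comment> \<open>The last coefficient 1 lies below the root of the discriminant, so the second
    branch of \<open>rho_r\<close> applies and returns the floor of \<open>sqrt d\<close>, that is
    \<open>n\<close>.\<close>
  moreover have "\<not> 2 * sqrt (real_of_int d) \<le> 1"
    using lo assms(1) by linarith
  ultimately have step: "rho (- d, 0, 1) = (1, 2 * n, n\<^sup>2 - d)"
    using s by (simp add: Let_def)
  have "disc (1, 2 * n, n\<^sup>2 - d) = 4 * d"
    by (simp add: power2_eq_square)
  moreover have "\<bar>2 * sqrt (real_of_int d) - 2\<bar> < 2 * real_of_int n"
    using lo hi assms(1) by linarith
  ultimately have red: "reduced (1, 2 * n, n\<^sup>2 - d)"
    using s d lo by simp
  \<comment> \<open>A reduced form has positive middle coefficient, as it exceeds an absolute value;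
    here it is 0, so step 2 is the first to reach a reduced form.\<close>
  have "\<not> reduced (norm_form d)" "\<not> reduced (- d, 0, 1)"
    by (simp_all add: norm_form_def)
  then show ?thesis
    using red step rho_norm_form[OF d]
    by (auto simp: is_reduction_def numeral_2_eq_2 less_Suc_eq)
qed

lemma power_dvd_mult_powers:
  fixes a b c :: "'a :: comm_semiring_1"
  assumes "c dvd a * b" and "m \<le> k" and "m \<le> l"
  shows "c ^ m dvd a ^ k * b ^ l"
proof -
  have "c ^ m dvd a ^ m * b ^ m"
    using dvd_power_same[OF assms(1), of m] by (simp add: power_mult_distrib)
  also have "a ^ m * b ^ m dvd a ^ k * b ^ l"
    using assms(2,3) by (intro mult_dvd_mono le_imp_power_dvd)
  finally show ?thesis .
qed

theorem theorem5p3: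
  fixes a b c h d1p d2p d1m d2m :: int and k l m :: nat
  assumes "a > 0" and "b > 0" and "c > 0" and "k > 0" and "l > 0" and "m > 0"
    and "c dvd a * b" and "k \<ge> m" and "l \<ge> m"
    and "h = (a ^ k * b ^ l) div (c ^ m)"
    and "d1p = a ^ (2 * k) * b ^ (2 * l) + c ^ m"
    and "d2p = a ^ (2 * k) * b ^ (2 * l) + 2 * c ^ m"
    and "d1m = a ^ (2 * k) * b ^ (2 * l) - c ^ m"
    and "d2m = a ^ (2 * k) * b ^ (2 * l) - 2 * c ^ m"
  shows "c ^ m dvd a ^ k * b ^ l \<and> h > 0 \<and>
    (d1p > 0 \<and> squarefree d1p \<longrightarrow>
       is_reduction (norm_form d1p) 2 (1, 2 * h * c ^ m, - (c ^ m))) \<and>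
    (d2p > 0 \<and> squarefree d2p \<longrightarrow>
       is_reduction (norm_form d2p) 2 (1, 2 * h * c ^ m, - (2 * c ^ m))) \<and>
    (d1m > 0 \<and> squarefree d1m \<longrightarrow>
       is_reduction (norm_form d1m) 2 (1, 2 * h * c ^ m - 2, 1 - (2 * h - 1) * c ^ m)) \<and>
    (d2m > 0 \<and> squarefree d2m \<and> h \<noteq> 1 \<longrightarrow>
       is_reduction (norm_form d2m) 2 (1, 2 * h * c ^ m - 2, 1 - 2 * (h - 1) * c ^ m))"
proof -
  define N C where "N = a ^ k * b ^ l" and "C = c ^ m"
  have dvd: "C dvd N"
    unfolding N_def C_def using assms by (intro power_dvd_mult_powers)
  have pos: "N > 0" "C > 0"
    using assms by (simp_all add: N_def C_def)
  have hC: "h * C = N"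
    using dvd assms(10) by (simp add: N_def C_def)
  then have h: "h > 0"
    using pos by (metis zero_less_mult_pos2)
  then have "C \<le> N"
    using hC pos mult_right_mono[of 1 h C] by simp
  have sq: "a ^ (2 * k) * b ^ (2 * l) = N\<^sup>2"
    by (simp add: N_def power_mult_distrib mult.commute flip: power_mult)
  have twice: "2 * h * C = 2 * N"
    using hC by simp
  \<comment> \<open>From C \<le> N, both N^2 + C and N^2 + 2C are at most N^2 + 2N, hence below (N +
    1)^2.\<close>
  have "is_reduction (norm_form (N\<^sup>2 + C)) 2 (1, 2 * N, - C)"
    using is_reduction_norm_form[of N "N\<^sup>2 + C"] pos \<open>C \<le> N\<close> by (simp add: power2_sum)
  moreover have "is_reduction (norm_form (N\<^sup>2 + 2 * C)) 2 (1, 2 * N, - (2 * C))"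
    using is_reduction_norm_form[of N "N\<^sup>2 + 2 * C"] pos \<open>C \<le> N\<close> by (simp add: power2_sum)
  moreover have "is_reduction (norm_form (N\<^sup>2 - C)) 2 (1, 2 * N - 2, 1 - (2 * h - 1) * C)"
    if "N\<^sup>2 - C > 0"
  proof -
    \<comment> \<open>With N \<ge> 2 the integer part N - 1 is at least 1, and C \<le> N < 2N - 1
      gives (N - 1)^2 < N^2 - C.\<close>
    have "N \<noteq> 1"
      using that pos by auto
    then have "is_reduction (norm_form (N\<^sup>2 - C)) 2 (1, 2 * (N - 1), (N - 1)\<^sup>2 - (N\<^sup>2 - C))"
      using pos \<open>C \<le> N\<close> by (intro is_reduction_norm_form) (auto simp: power2_diff)
    moreover have "(N - 1)\<^sup>2 - (N\<^sup>2 - C) = 1 - (2 * h - 1) * C"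
      using twice by (simp add: power2_diff algebra_simps)
    moreover have "2 * (N - 1) = 2 * N - 2"
      by simp
    ultimately show ?thesis
      by (simp only:)
  qed
  moreover have "is_reduction (norm_form (N\<^sup>2 - 2 * C)) 2 (1, 2 * N - 2, 1 - 2 * (h - 1) * C)"
    if "h \<noteq> 1"
  proof -
    \<comment> \<open>Here h \<ge> 2, so 2C \<le> N < 2N - 1 and (N - 1)^2 < N^2 - 2C. For h = 1
      this fails, since then 2C = 2N.\<close>
    have "2 * C \<le> N"
      using h that hC pos mult_right_mono[of 2 h C] by simp
    then have "is_reduction (norm_form (N\<^sup>2 - 2 * C)) 2
        (1, 2 * (N - 1), (N - 1)\<^sup>2 - (N\<^sup>2 - 2 * C))"
      using pos by (intro is_reduction_norm_form) (auto simp: power2_diff)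
    moreover have "(N - 1)\<^sup>2 - (N\<^sup>2 - 2 * C) = 1 - 2 * (h - 1) * C"
      using twice by (simp add: power2_diff algebra_simps)
    moreover have "2 * (N - 1) = 2 * N - 2"
      by simp
    ultimately show ?thesis
      by (simp only:)
  qed
  ultimately show ?thesis
    using dvd h unfolding assms(11-14) sq N_def[symmetric] C_def[symmetric] twice by blast
qed

end
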